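(* Let $\mathcal H$ be a finite-dimensional real Hilbert space, let $S^-,S^+\subset\mathcal H$ be disjoint nonempty compact subsets, and set $D:=d(S^-,S^+)>0$ and $\rho(q):=\min\{d(q,S^-),d(q,S^+)\}$ for $q\in\mathcal H$. Let $W:\mathcal H\to[0,\infty)$ be continuous, let $g:[0,D/2)\to[0,\infty)$ be Borel measurable and locally bounded, and suppose that $W(q)\ge g(\rho(q))$ whenever $\rho(q)<D/2$. Suppose in addition that $$W^{-1}(0)=S^-\cup S^+,\qquad g(s)>0\quad\text{for }0<s<D/2 .$$ Let $A^-\in S^-$ and $A^+\in S^+$, and let $\Psi\in H^1_{\mathrm{loc}}(\mathbb R;\mathcal H)$ have finite energy, have limits $\Psi(-\infty)=A^-$ and $\Psi(+\infty)=A^+$, and satisfy $$\int_{\mathbb R}\bigl(\lVert\Psi'\rVert^2+W(\Psi)\bigr)\,dz=4\int_0^{D/2}\sqrt{g(s)}\,ds .$$ Then $$\lVert A^+-A^-\rVert=D .$$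
   Context: For a nonempty compact set $S\subset\mathcal H$, $d(q,S)=\min_{p\in S}\lVert q-p\rVert$, and $d(S^-,S^+)=\min_{p\in S^-,q\in S^+}\lVert p-q\rVert$. The energy of $\Psi$ is $\int_{\mathbb R}(\lVert\Psi'\rVert^2+W(\Psi))\,dz$, and finite energy means that this quantity is finite. $\Psi(\pm\infty)$ denotes $\lim_{z\to\pm\infty}\Psi(z)$ (of the continuous representative). *)

theory Defs
  imports "HOL-Analysis.Analysis"
begin

definition test_function :: "(real \<Rightarrow> real) \<Rightarrow> bool" where
  "test_function \<phi> \<longleftrightarrow>
     (\<forall>n. (deriv ^^ n) \<phi> differentiable_on UNIV) \<and> compact (closure {x. \<phi> x \<noteq> 0})"

definition locally_L1 :: "(real \<Rightarrow> 'a::euclidean_space) \<Rightarrow> bool" where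
  "locally_L1 u \<longleftrightarrow> (\<forall>K. compact K \<longrightarrow> u absolutely_integrable_on K)"

definition locally_L2 :: "(real \<Rightarrow> 'a::euclidean_space) \<Rightarrow> bool" where
  "locally_L2 u \<longleftrightarrow> u \<in> borel_measurable lebesgue \<and>
     (\<forall>K. compact K \<longrightarrow> (\<lambda>x. (norm (u x))\<^sup>2) absolutely_integrable_on K)"

definition has_weak_deriv ::
    "(real \<Rightarrow> 'a::euclidean_space) \<Rightarrow> (real \<Rightarrow> 'a) \<Rightarrow> bool" where
  "has_weak_deriv u v \<longleftrightarrow> locally_L1 u \<and> locally_L1 v \<and>
     (\<forall>\<phi>. test_function \<phi> \<longrightarrow>
        (LINT x|lebesgue. deriv \<phi> x *\<^sub>R u x) = - (LINT x|lebesgue. \<phi> x *\<^sub>R v x))"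

text \<open>Elements of the Sobolev space are represented by arbitrary functions, so the weak
  derivative is determined only up to a null set; the choice made here does not affect
  the energy.\<close>

definition weak_deriv :: "(real \<Rightarrow> 'a::euclidean_space) \<Rightarrow> real \<Rightarrow> 'a" where
  "weak_deriv u = (SOME v. has_weak_deriv u v)"

definition H1_loc :: "(real \<Rightarrow> 'a::euclidean_space) set" where
  "H1_loc = {u. locally_L2 u \<and> (\<exists>v. locally_L2 v \<and> has_weak_deriv u v)}"

definition energy :: "('a::euclidean_space \<Rightarrow> real) \<Rightarrow> (real \<Rightarrow> 'a) \<Rightarrow> ennreal" where
  "energy W u = (\<integral>\<^sup>+ z. ennreal ((norm (weak_deriv u z))\<^sup>2 + W (u z)) \<partial>lebesgue)"

text \<open>The limit of the continuous representative of \<open>u\<close>, which is unique if it exists and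
  does exist for every \<open>u \<in> H1_loc\<close>.\<close>

definition cont_rep_tendsto ::
    "(real \<Rightarrow> 'a::euclidean_space) \<Rightarrow> 'a \<Rightarrow> real filter \<Rightarrow> bool" where
  "cont_rep_tendsto u l F \<longleftrightarrow>
     (\<exists>v. continuous_on UNIV v \<and> (AE x in lebesgue. v x = u x) \<and> (v \<longlongrightarrow> l) F)"

definition locally_bounded_on :: "real set \<Rightarrow> (real \<Rightarrow> real) \<Rightarrow> bool" where
  "locally_bounded_on I g \<longleftrightarrow> (\<forall>s\<in>I. \<exists>e>0. bounded (g ` (I \<inter> ball s e)))"

end

theory Submission
  imports Defs "HOL-Computational_Algebra.Polynomial"
begin

text \<open>Let \<open>v\<close> be the continuous representative of \<open>\<Psi>\<close> and \<open>N\<close> the image under \<open>\<rho> \<circ> v\<close> of the arc length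
  measure \<open>\<parallel>\<Psi>'\<parallel> dz\<close>. Since \<open>v\<close> has to leave \<open>Sm\<close> and to approach \<open>Sp\<close>, every interval in \<open>(0, D/2)\<close> has
  \<open>N\<close>-measure at least twice its length, so \<open>N\<close> dominates twice the Lebesgue measure there. With
  \<open>\<parallel>\<Psi>'\<parallel>\<^sup>2 + W(\<Psi>) \<ge> 2 \<parallel>\<Psi>'\<parallel> \<surd>g(\<rho>(\<Psi>))\<close> on \<open>{0 < \<rho>(\<Psi>) < D/2}\<close>, the assumed value of the energy forces
  equality everywhere. As \<open>g > 0\<close>, equality of the integrals of \<open>\<surd>g\<close> gives \<open>N = 2 dz\<close> on \<open>(0, D/2)\<close>, and
  equality in the pointwise estimate gives \<open>\<Psi>' = 0\<close> almost everywhere off \<open>{0 < \<rho>(\<Psi>) < D/2}\<close>. Hence the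
  whole curve has length \<open>D\<close>, which bounds the distance of its end points.\<close>

section \<open>Smooth step functions\<close>

text \<open>Differentiability is recorded through an explicit derivative at each stage rather than
  through \<open>deriv\<close>, so that closure under sums, products and affine substitution follows
  by induction on the order.\<close>

primrec times_differentiable :: "nat \<Rightarrow> (real \<Rightarrow> real) \<Rightarrow> bool" where
  "times_differentiable 0 f \<longleftrightarrow> True"
| "times_differentiable (Suc n) f \<longleftrightarrow>
     (\<exists>f'. (\<forall>x. (f has_real_derivative f' x) (at x)) \<and> times_differentiable n f')"

lemma times_differentiable_SucD: "times_differentiable (Suc n) f \<Longrightarrow> times_differentiable n f"
  by (induction n arbitrary: f) auto

lemma times_differentiable_SucI:
  "(\<And>x. (f has_real_derivative f' x) (at x)) \<Longrightarrow> times_differentiable n f' \<Longrightarrow> times_differentiable (Suc n) f"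
  by auto

lemma times_differentiable_add:
  "times_differentiable n f \<Longrightarrow> times_differentiable n g \<Longrightarrow> times_differentiable n (\<lambda>x. f x + g x)"
proof (induction n arbitrary: f g)
  case (Suc n)
  then obtain f' g' where "\<And>x. (f has_real_derivative f' x) (at x)" "times_differentiable n f'"
    "\<And>x. (g has_real_derivative g' x) (at x)" "times_differentiable n g'" by auto
  with Suc.IH show ?case
    by (auto intro!: exI[of _ "\<lambda>x. f' x + g' x"] derivative_intros)
qed simp

lemma times_differentiable_mult:
  "times_differentiable n f \<Longrightarrow> times_differentiable n g \<Longrightarrow> times_differentiable n (\<lambda>x. f x * g x)"
proof (induction n arbitrary: f g)
  case (Suc n)
  then obtain f' g' where 1: "\<And>x. (f has_real_derivative f' x) (at x)" "times_differentiable n f'"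
    "\<And>x. (g has_real_derivative g' x) (at x)" "times_differentiable n g'" by auto
  \<comment> \<open>The product rule keeps the factors \<open>f\<close> and \<open>g\<close>
    themselves; one of their orders of differentiability is given up so that the induction
    hypothesis applies.\<close>
  have "times_differentiable n (\<lambda>x. f' x * g x + g' x * f x)"
    using Suc 1 by (intro times_differentiable_add Suc.IH) (auto simp del: times_differentiable.simps dest: times_differentiable_SucD)
  moreover have "((\<lambda>x. f x * g x) has_real_derivative f' x * g x + g' x * f x) (at x)" for x
    by (intro DERIV_mult 1)
  ultimately show ?case
    by (rule times_differentiable_SucI[rotated])
qed simp

lemma times_differentiable_const: "times_differentiable n (\<lambda>x. c)"
  by (induction n arbitrary: c) (auto intro!: exI[of _ "\<lambda>x. 0"])

lemma times_differentiable_affine: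
  "times_differentiable n f \<Longrightarrow> times_differentiable n (\<lambda>x. f (a * x + b))"
proof (induction n arbitrary: f)
  case (Suc n)
  then obtain f' where 1: "\<And>x. (f has_real_derivative f' x) (at x)" "times_differentiable n f'"
    by auto
  have "((\<lambda>x. f (a * x + b)) has_real_derivative f' (a * x + b) * a) (at x)" for x
    by (rule DERIV_chain2[OF 1(1)]) (auto intro!: derivative_eq_intros)
  moreover have "times_differentiable n (\<lambda>x. f' (a * x + b) * a)"
    by (intro times_differentiable_mult times_differentiable_const Suc.IH 1)
  ultimately show ?case by (rule times_differentiable_SucI)
qed simp

text \<open>Derivatives are unique, so the witness at each stage is \<open>deriv\<close> of the
  previous function. The order is \<open>Suc n\<close> because the n-th derivative must itself be
  differentiable.\<close>

lemma times_differentiable_deriv: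
  "times_differentiable (Suc n) f \<Longrightarrow> (deriv ^^ n) f differentiable_on UNIV"
proof (induction n arbitrary: f)
  case 0
  then show ?case
    by (auto simp: differentiable_on_def real_differentiable_def intro: differentiable_at_withinI)
next
  case (Suc n)
  then obtain f' where 1: "\<And>x. (f has_real_derivative f' x) (at x)" "times_differentiable (Suc n) f'"
    by auto
  then have "deriv f = f'" by (auto intro: DERIV_imp_deriv)
  with Suc.IH[OF 1(2)] show ?case by (simp only: funpow_Suc_right o_def)
qed

text \<open>The class of these functions is closed under differentiation, so \<open>flat 1\<close>, which is
  \<open>exp (- 1 / x)\<close> on the positive axis, is smooth.\<close>

definition flat :: "real poly \<Rightarrow> real \<Rightarrow> real" where
  "flat p x = (if x > 0 then poly p (inverse x) * exp (- inverse x) else 0)"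

text \<open>With \<open>y = 1 / x\<close> this is the flatness of \<open>exp (- 1 / x)\<close> at 0
  from the right: it beats every power of \<open>1 / x\<close>.\<close>

lemma poly_exp_tendsto_0: "((\<lambda>y. poly p y * exp (- y)) \<longlongrightarrow> (0::real)) at_top"
proof -
  have "((\<lambda>y. \<Sum>i\<le>degree p. coeff p i * (y ^ i / exp y)) \<longlongrightarrow> (\<Sum>i\<le>degree p. coeff p i * 0)) at_top"
    by (intro tendsto_intros tendsto_power_div_exp_0)
  then show ?thesis
    by (simp add: poly_altdef sum_distrib_right exp_minus divide_inverse mult.assoc)
qed

text \<open>In the variable \<open>y = 1 / x\<close> one has d/dx = - y^2 d/dy, which turns
  \<open>p(y) exp (- y)\<close> into \<open>y^2 (p(y) - p'(y)) exp (- y)\<close>. Away from 0 this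
  is a computation; at 0 the difference quotients tend to 0 from both sides.\<close>

lemma flat_has_derivative:
  "(flat p has_real_derivative flat (monom 1 2 * (p - pderiv p)) x) (at x)"
proof -
  consider "x > 0" | "x < 0" | "x = 0" by linarith
  then show ?thesis
  proof cases
    case 1
    have "((\<lambda>x. poly p (inverse x) * exp (- inverse x)) has_real_derivative
       flat (monom 1 2 * (p - pderiv p)) x) (at x)"
      using 1 by (auto intro!: derivative_eq_intros simp: flat_def poly_monom field_simps power2_eq_square)
    moreover have "eventually (\<lambda>y. y > 0) (nhds x)"
      using 1 by (intro eventually_nhds_in_open[of "{0<..}", simplified]) auto
    then have "eventually (\<lambda>y. flat p y = poly p (inverse y) * exp (- inverse y)) (nhds x)"
      by eventually_elim (simp add: flat_def)
    ultimately show ?thesis by (simp add: DERIV_cong_ev)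
  next
    case 2
    have "eventually (\<lambda>y. y < 0) (nhds x)"
      using 2 by (intro eventually_nhds_in_open[of "{..<0}", simplified]) auto
    then have "eventually (\<lambda>y. flat p y = 0) (nhds x)"
      by eventually_elim (simp add: flat_def)
    then show ?thesis using 2 by (subst DERIV_cong_ev[OF refl _ refl]) (auto simp: flat_def)
  next
    case 3
    have "((\<lambda>h. flat p h / h) \<longlongrightarrow> 0) (at_left 0)"
      by (rule tendsto_eventually) (auto simp: flat_def eventually_at_filter)
    \<comment> \<open>Dividing by \<open>h\<close> multiplies the polynomial by
      \<open>inverse h\<close>, and \<open>pCons 0 p\<close> is the polynomial
      \<open>y * p(y)\<close>.\<close>
    moreover have "((\<lambda>h. poly (pCons 0 p) (inverse h) * exp (- inverse h)) \<longlongrightarrow> 0) (at_right 0)"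
      by (rule filterlim_compose[OF poly_exp_tendsto_0 filterlim_inverse_at_top_right])
    then have "((\<lambda>h. flat p h / h) \<longlongrightarrow> 0) (at_right 0)"
      by (rule Lim_transform_eventually) (auto simp: flat_def eventually_at_filter field_simps)
    ultimately have "((\<lambda>h. flat p h / h) \<longlongrightarrow> 0) (at 0)"
      by (simp add: filterlim_at_split)
    then show ?thesis using 3 by (simp add: DERIV_def flat_def)
  qed
qed

lemma times_differentiable_flat: "times_differentiable n (flat p)"
  by (induction n arbitrary: p) (use flat_has_derivative in auto)

text \<open>\<open>H\<close> is the normalised antiderivative of a smooth bump supported in
  \<open>{0..1}\<close>, and \<open>b\<close> is the bump scaled to total mass 1.\<close>

lemma smooth_step_exists:
  obtains H b :: "real \<Rightarrow> real" where
    "\<And>n. times_differentiable n H" "\<And>x. (H has_real_derivative b x) (at x)"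
    "\<And>x. 0 \<le> b x" "continuous_on UNIV b" "\<And>x. x \<notin> {0..1} \<Longrightarrow> b x = 0"
    "\<And>x. x \<le> 0 \<Longrightarrow> H x = 0" "\<And>x. 1 \<le> x \<Longrightarrow> H x = 1" "\<And>x. 0 \<le> H x" "\<And>x. H x \<le> 1"
proof -
  \<comment> \<open>The first factor is positive exactly for \<open>x > 0\<close>, the second
    exactly for \<open>x < 1\<close>. Writing the argument as \<open>-1 * x + 1\<close> fits the
    affine substitution lemma.\<close>
  define c where "c x = flat 1 x * flat 1 (-1 * x + 1)" for x
  have c_diff: "times_differentiable n c" for n
    unfolding c_def by (intro times_differentiable_mult times_differentiable_affine times_differentiable_flat)
  have c_cont: "continuous_on UNIV c"
    using c_diff[of 1] by (auto simp: continuous_on_eq_continuous_at intro: DERIV_isCont)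
  have c_nonneg: "0 \<le> c x" for x by (simp add: c_def flat_def)
  have c_pos: "0 < c x" if "x \<in> {0<..<1}" for x using that by (simp add: c_def flat_def)
  have c_zero: "c x = 0" if "x \<notin> {0<..<1}" for x using that by (auto simp: c_def flat_def)
  obtain F where "\<And>x. (F has_vector_derivative c x) (at x)"
    using einterval_antiderivative[of "-\<infinity>" "\<infinity>" c] c_cont
    by (auto simp: continuous_on_eq_continuous_at)
  then have F: "(F has_real_derivative c x) (at x)" for x
    by (simp add: has_real_derivative_iff_has_vector_derivative)
  have mono: "F x \<le> F y" if "x \<le> y" for x y
    using that F c_nonneg by (intro DERIV_nonneg_imp_nondecreasing[of x y F]) auto
  have eq: "F x = F y" if "x \<le> y" "y \<le> 0 \<or> 1 \<le> x" for x y
  proof (cases "x = y")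
    case False
    with that have "x < y" by simp
    obtain z where "z > x" "z < y" "F y - F x = (y - x) * c z" 
      using MVT2[of x y F c] \<open>x < y\<close> F by auto
    moreover have "c z = 0" using that \<open>x < z\<close> \<open>z < y\<close> by (intro c_zero) auto
    ultimately show ?thesis by simp
  qed simp
  \<comment> \<open>Positivity of the bump inside the unit interval makes the increment of
    \<open>F\<close> positive, so \<open>F\<close> can be normalised.\<close>
  obtain z where "z > 0" "z < 1" "F 1 - F 0 = (1 - 0) * c z" using MVT2[of 0 1 F c] F by auto
  then have pos: "F 1 - F 0 > 0" using c_pos[of z] by simp
  define k where "k = inverse (F 1 - F 0)"
  have k: "k > 0" "k * (F 1 - F 0) = 1" using pos by (auto simp: k_def)
  let ?H = "\<lambda>x. k * (F x - F 0)" let ?b = "\<lambda>x. k * c x"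
  have H': "(?H has_real_derivative ?b x) (at x)" for x
    using F by (auto intro!: derivative_eq_intros)
  have 0: "?H x = 0" if "x \<le> 0" for x using eq[of x 0] that by simp
  have 1: "?H x = 1" if "1 \<le> x" for x using eq[of 1 x] that k by simp
  have bounds: "0 \<le> ?H x" "?H x \<le> 1" for x
  proof -
    have "F x \<ge> F 0" using eq[of x 0] mono[of 0 x] by fastforce
    then show "0 \<le> ?H x" using k by simp
    have "F x \<le> F 1" using eq[of 1 x] mono[of x 1] by fastforce
    then have "?H x \<le> k * (F 1 - F 0)" using k(1) by (intro mult_left_mono) auto
    then show "?H x \<le> 1" using k by simp
  qed
  show ?thesis
  proof (rule that[OF _ H' _ _ _ 0 1 bounds])
    show "times_differentiable n ?H" for n
    proof (cases n)
      case (Suc m)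
      have "times_differentiable m ?b" by (intro times_differentiable_mult times_differentiable_const c_diff)
      then show ?thesis unfolding Suc by (rule times_differentiable_SucI[OF H'])
    qed simp
    show "0 \<le> ?b x" for x using c_nonneg k by simp
    show "continuous_on UNIV ?b" by (intro continuous_intros c_cont)
    show "?b x = 0" if "x \<notin> {0..1}" for x using that c_zero[of x] by auto
  qed
qed

text \<open>The first rescaled step switches on just after \<open>s\<close>, the second switches it
  off just after \<open>t\<close>. Since \<open>m \<ge> 1\<close>, the support stays in
  \<open>{s..t + 1}\<close> whatever \<open>m\<close> is, as needed for domination when
  \<open>m\<close> grows.\<close>

lemma test_function_smooth_step:
  assumes H: "\<And>n. times_differentiable n H" and b: "\<And>x. (H has_real_derivative b x) (at x)"
    and H0: "\<And>x. x \<le> 0 \<Longrightarrow> H x = 0" and H1: "\<And>x. 1 \<le> x \<Longrightarrow> H x = 1" and m: "m \<ge> 1" and st: "s \<le> t"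
  defines "\<phi> \<equiv> \<lambda>x. H (m * (x - s)) - H (m * (x - t))"
  shows "test_function \<phi>" "deriv \<phi> x = m * b (m * (x - s)) - m * b (m * (x - t))"
    "x \<notin> {s..t + 1} \<Longrightarrow> \<phi> x = 0"
proof -
  show zero: "\<phi> x = 0" if "x \<notin> {s..t + 1}" for x
  proof (cases "x < s")
    case True
    then have "m * (x - s) \<le> 0" "m * (x - t) \<le> 0" using m st
      by (auto simp: mult_le_0_iff)
    then show ?thesis using H0 by (simp add: \<phi>_def)
  next
    case False
    then have "x - t \<ge> 1" "x - s \<ge> 1" using that st by auto
    then have "m * (x - s) \<ge> 1" "m * (x - t) \<ge> 1" using m mult_mono[of 1 m 1 "x-s"] mult_mono[of 1 m 1 "x-t"] by auto
    then show ?thesis using H1 by (simp add: \<phi>_def)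
  qed
  have "times_differentiable n (\<lambda>x. H (m * x + (- m * s)) + (-1) * H (m * x + (- m * t)))" for n
    by (intro times_differentiable_mult times_differentiable_add times_differentiable_const times_differentiable_affine H)
  then have "times_differentiable n \<phi>" for n
    by (simp add: \<phi>_def algebra_simps)
  then have "\<forall>n. (deriv ^^ n) \<phi> differentiable_on UNIV"
    using times_differentiable_deriv by blast
  moreover have "{x. \<phi> x \<noteq> 0} \<subseteq> {s..t + 1}" using zero by blast
  then have "closure {x. \<phi> x \<noteq> 0} \<subseteq> {s..t + 1}" by (rule closure_minimal) simp
  then have "compact (closure {x. \<phi> x \<noteq> 0})"
    by (meson bounded_closed_interval bounded_subset closed_closure compact_eq_bounded_closed)
  ultimately show "test_function \<phi>" by (simp add: test_function_def)
  have aff: "((\<lambda>x. H (m * (x - r))) has_real_derivative m * b (m * (x - r))) (at x)" for x r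
    by (subst mult.commute, rule DERIV_chain2[OF b]) (auto intro!: derivative_eq_intros)
  show "deriv \<phi> x = m * b (m * (x - s)) - m * b (m * (x - t))"
    unfolding \<phi>_def
    by (intro DERIV_imp_deriv DERIV_diff aff)
qed

section \<open>The fundamental theorem of calculus for weak derivatives\<close>

lemma continuous_on_imp_lebesgue_measurable:
  fixes f :: "'a::euclidean_space \<Rightarrow> 'b::topological_space"
  shows "continuous_on UNIV f \<Longrightarrow> f \<in> borel_measurable lebesgue"
  by (intro measurable_completion) (simp add: borel_measurable_continuous_onI)

text \<open>The truncations to \<open>{- real n..real n}\<close> are measurable and at each point
  eventually equal to \<open>w\<close>.\<close>

lemma locally_L1_measurable:
  assumes "locally_L1 w"
  shows "w \<in> borel_measurable lebesgue"
proof (rule borel_measurable_LIMSEQ_metric)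
  show "(\<lambda>x. indicator {- real n..real n} x *\<^sub>R w x) \<in> borel_measurable lebesgue" for n
    using assms by (auto simp: locally_L1_def set_integrable_def dest!: spec[of _ "{- real n..real n}"])
  show "(\<lambda>n. indicator {- real n..real n} x *\<^sub>R w x) \<longlonglongrightarrow> w x" for x
  proof (rule tendsto_eventually)
    obtain k :: nat where "\<bar>x\<bar> \<le> real k" using real_arch_simple by blast
    then have "\<And>n. n \<ge> k \<Longrightarrow> \<bar>x\<bar> \<le> real n" by (meson of_nat_le_iff order_trans)
    then show "\<forall>\<^sub>F n in sequentially. indicator {- real n..real n} x *\<^sub>R w x = w x"
      by (fastforce simp: eventually_sequentially indicator_def abs_le_iff intro!: exI[of _ k])
  qed
qed

text \<open>The substitution \<open>x = r + y / real (Suc n)\<close> moves the scaling from the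
  kernel into the argument of \<open>v\<close>; dominated convergence and continuity at
  \<open>r\<close> then finish.\<close>

lemma approximate_identity:
  fixes v :: "real \<Rightarrow> 'a::euclidean_space"
  assumes v: "continuous_on UNIV v"
    and b: "continuous_on UNIV b" "\<And>x. x \<notin> {0..1} \<Longrightarrow> b x = 0" "(LINT x|lebesgue. b x) = 1"
  shows "(\<lambda>n. LINT x|lebesgue. (real (Suc n) * b (real (Suc n) * (x - r))) *\<^sub>R v x) \<longlonglongrightarrow> v r"
proof -
  \<comment> \<open>A function that is not integrable has integral 0 by convention, so the value 1
    already gives integrability.\<close>
  have int: "integrable lebesgue b"
    using b(3) not_integrable_integral_eq[of lebesgue b] by fastforce
  have eq: "(LINT x|lebesgue. (real (Suc n) * b (real (Suc n) * (x - r))) *\<^sub>R v x)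
      = (LINT y|lebesgue. b y *\<^sub>R v (r + y / real (Suc n)))" for n
  proof -
    let ?m = "real (Suc n)"
    have "(LINT x|lebesgue. (?m * b (?m * (x - r))) *\<^sub>R v x) =
       \<bar>1 / ?m\<bar> *\<^sub>R (LINT y|lebesgue. (?m * b (?m * ((r + 1 / ?m * y) - r))) *\<^sub>R v (r + 1 / ?m * y))"
      by (rule lebesgue_integral_real_affine) simp
    also have "\<dots> = (LINT y|lebesgue. \<bar>1 / ?m\<bar> *\<^sub>R ((?m * b (?m * ((r + 1 / ?m * y) - r))) *\<^sub>R v (r + 1 / ?m * y)))"
      by (rule integral_scaleR_right[symmetric]) 
    also have "\<dots> = (LINT y|lebesgue. b y *\<^sub>R v (r + y / ?m))"
      by (intro Bochner_Integration.integral_cong refl) (simp del: of_nat_Suc)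
    finally show ?thesis .
  qed
  \<comment> \<open>For \<open>y\<close> in the support \<open>{0..1}\<close> of \<open>b\<close>
    the point \<open>r + y / real (Suc n)\<close> lies in \<open>{r..r+1}\<close>, so a bound of
    \<open>v\<close> there serves all \<open>n\<close>.\<close>
  have "compact (v ` {r..r+1})" using v by (intro compact_continuous_image) (auto intro: continuous_on_subset)
  then obtain M where M: "\<And>x. x \<in> {r..r+1} \<Longrightarrow> norm (v x) \<le> M"
    using compact_imp_bounded[of "v ` {r..r+1}"] unfolding bounded_iff by (metis image_eqI)
  have "(\<lambda>n. LINT y|lebesgue. b y *\<^sub>R v (r + y / real (Suc n))) \<longlonglongrightarrow> (LINT y|lebesgue. b y *\<^sub>R v r)"
  proof (rule integral_dominated_convergence[where w = "\<lambda>y. M * norm (b y)"])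
    show "(\<lambda>y. b y *\<^sub>R v r) \<in> borel_measurable lebesgue"
      by (intro continuous_on_imp_lebesgue_measurable continuous_intros b)
    show "(\<lambda>y. b y *\<^sub>R v (r + y / real (Suc n))) \<in> borel_measurable lebesgue" for n
      by (intro continuous_on_imp_lebesgue_measurable continuous_intros b continuous_on_compose2[OF v]) auto
    show "integrable lebesgue (\<lambda>y. M * norm (b y))" using int by simp
    show "AE y in lebesgue. (\<lambda>n. b y *\<^sub>R v (r + y / real (Suc n))) \<longlonglongrightarrow> b y *\<^sub>R v r"
    proof (intro AE_I2 tendsto_intros)
      fix y
      have "(\<lambda>n. r + y / real (Suc n)) \<longlonglongrightarrow> r + 0"
        by (intro tendsto_intros LIMSEQ_Suc lim_const_over_n)
      then show "(\<lambda>n. v (r + y / real (Suc n))) \<longlonglongrightarrow> v r"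
        using v by (auto simp: continuous_on_eq_continuous_at intro: isCont_tendsto_compose)
    qed
    show "AE y in lebesgue. norm (b y *\<^sub>R v (r + y / real (Suc n))) \<le> M * norm (b y)" for n
    proof (intro AE_I2)
      fix y show "norm (b y *\<^sub>R v (r + y / real (Suc n))) \<le> M * norm (b y)"
      proof (cases "y \<in> {0..1}")
        case True
        then have "norm (v (r + y / real (Suc n))) \<le> M" by (intro M) (auto simp: field_simps)
        then show ?thesis by (metis abs_ge_zero mult.commute mult_right_mono norm_scaleR real_norm_def)
      qed (use b in simp)
    qed
  qed
  then show ?thesis using b(3) int unfolding eq by simp
qed

text \<open>Test the weak derivative against smoothed indicator functions of \<open>{s<..t}\<close>.\<close>

lemma weak_deriv_FTC:
  assumes uw: "has_weak_deriv u w" and v: "continuous_on UNIV v" and ae: "AE x in lebesgue. v x = u x"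
    and st: "s \<le> t"
  shows "v t - v s = (LINT x:{s<..t}|lebesgue. w x)"
proof -
  obtain H b :: "real \<Rightarrow> real" where H: "\<And>n. times_differentiable n H" "\<And>x. (H has_real_derivative b x) (at x)"
    "\<And>x. 0 \<le> b x" "continuous_on UNIV b" "\<And>x. x \<notin> {0..1} \<Longrightarrow> b x = 0"
    "\<And>x. x \<le> 0 \<Longrightarrow> H x = 0" "\<And>x. 1 \<le> x \<Longrightarrow> H x = 1" "\<And>x. 0 \<le> H x" "\<And>x. H x \<le> 1"
    using smooth_step_exists by metis
  have "(b has_integral H 1 - H 0) {0..1}"
    using H(2) by (intro fundamental_theorem_of_calculus)
      (auto simp: has_real_derivative_iff_has_vector_derivative intro: has_vector_derivative_at_within)
  then have hi: "(b has_integral 1) {0..1}" using H(6)[of 0] H(7)[of 1] by simp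
  then have "set_integrable lebesgue {0..1} b"
    using H(3) by (intro nonnegative_absolutely_integrable_1) auto
  then have "(LINT x:{0..1}|lebesgue. b x) = 1"
    using hi set_lebesgue_integral_eq_integral(2) integral_unique by metis
  moreover have "indicator {0..1} x *\<^sub>R b x = b x" for x using H(5)[of x] by (auto simp: indicator_def)
  ultimately have b1: "(LINT x|lebesgue. b x) = 1" by (simp only: set_lebesgue_integral_def)
  have w: "w \<in> borel_measurable lebesgue" and u: "u \<in> borel_measurable lebesgue"
    using uw locally_L1_measurable by (auto simp: has_weak_deriv_def)
  have vm: "v \<in> borel_measurable lebesgue" using v by (rule continuous_on_imp_lebesgue_measurable)
  define \<phi> where "\<phi> n x = H (real (Suc n) * (x - s)) - H (real (Suc n) * (x - t))" for n x
  note \<phi> = test_function_smooth_step[OF H(1,2,6,7), of "real (Suc _)" s t, folded \<phi>_def]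
  have \<phi>_test: "test_function (\<phi> n)"
    and \<phi>_deriv: "deriv (\<phi> n) x = real (Suc n) * b (real (Suc n) * (x - s)) - real (Suc n) * b (real (Suc n) * (x - t))"
    and \<phi>_zero: "x \<notin> {s..t + 1} \<Longrightarrow> \<phi> n x = 0" for n x
    using \<phi>[of n] st by auto
  have \<phi>_cont: "continuous_on UNIV (\<phi> n)" for n
  proof -
    have H_cont: "continuous_on UNIV H" using H(2) by (auto simp: continuous_on_eq_continuous_at intro: DERIV_isCont)
    show ?thesis unfolding \<phi>_def
      by (intro continuous_intros continuous_on_compose2[OF H_cont]) auto
  qed
  let ?J = "\<lambda>r n x. (real (Suc n) * b (real (Suc n) * (x - r))) *\<^sub>R v x"
  have J_int: "integrable lebesgue (?J r n)" for r n
  proof -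
    \<comment> \<open>Scaling by a factor of at least 1 keeps the kernel supported within distance 1
      to the right of \<open>r\<close>, hence on a compact interval.\<close>
    have zero: "?J r n x = 0" if "x \<notin> {r..r+1}" for x
    proof -
      have "real (Suc n) * (x - r) \<notin> {0..1}"
      proof (cases "x < r")
        case True
        then show ?thesis by (simp add: zero_le_mult_iff)
      next
        case False
        then have "1 < x - r" using that by auto
        moreover have "1 * (x - r) \<le> real (Suc n) * (x - r)" using \<open>1 < x - r\<close> by (intro mult_right_mono) auto
        ultimately have "1 < real (Suc n) * (x - r)" by (metis less_le_trans mult_1)
        then show ?thesis by (simp del: of_nat_Suc)
      qed
      then show ?thesis using H(5) by simp
    qed
    have "continuous_on {r..r+1} (?J r n)"
      by (intro continuous_intros continuous_on_compose2[OF H(4)] continuous_on_subset[OF v]) auto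
    then have "set_integrable lebesgue {r..r+1} (?J r n)"
      by (intro absolutely_integrable_continuous_real)
    moreover have "indicator {r..r+1} x *\<^sub>R ?J r n x = ?J r n x" for x using zero[of x] by (auto simp: indicator_def)
    ultimately show ?thesis by (simp only: set_integrable_def)
  qed
  \<comment> \<open>\<open>deriv (\<phi> n)\<close> is a bump at \<open>s\<close> minus a bump at
    \<open>t\<close>; the minus sign in the weak derivative exchanges them. Replacing
    \<open>u\<close> by \<open>v\<close> changes no integral.\<close>
  have "(LINT x|lebesgue. \<phi> n x *\<^sub>R w x) = (LINT x|lebesgue. ?J t n x) - (LINT x|lebesgue. ?J s n x)" for n
  proof -
    have dm: "deriv (\<phi> n) \<in> borel_measurable lebesgue"
    proof -
      have "continuous_on UNIV (deriv (\<phi> n))" unfolding \<phi>_deriv[abs_def]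
        by (intro continuous_intros continuous_on_compose2[OF H(4)]) auto
      then show ?thesis by (rule continuous_on_imp_lebesgue_measurable)
    qed
    have "- (LINT x|lebesgue. \<phi> n x *\<^sub>R w x) = (LINT x|lebesgue. deriv (\<phi> n) x *\<^sub>R u x)"
      using uw \<phi>_test[of n] by (simp add: has_weak_deriv_def)
    also have "\<dots> = (LINT x|lebesgue. deriv (\<phi> n) x *\<^sub>R v x)"
      using ae by (intro integral_cong_AE borel_measurable_scaleR dm u vm) auto
    also have "\<dots> = (LINT x|lebesgue. ?J s n x - ?J t n x)"
      by (simp only: \<phi>_deriv scaleR_diff_left)
    also have "\<dots> = (LINT x|lebesgue. ?J s n x) - (LINT x|lebesgue. ?J t n x)"
      by (rule Bochner_Integration.integral_diff[OF J_int J_int])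
    finally show ?thesis by (simp add: algebra_simps)
  qed
  then have lim1: "(\<lambda>n. LINT x|lebesgue. \<phi> n x *\<^sub>R w x) \<longlonglongrightarrow> v t - v s"
    by (simp only:) (intro tendsto_diff approximate_identity[OF v H(4,5) b1])
  \<comment> \<open>All \<open>\<phi> n\<close> are bounded by 1 and supported in
    \<open>{s..t+1}\<close>, where \<open>w\<close> is integrable.\<close>
  have "(\<lambda>n. LINT x|lebesgue. \<phi> n x *\<^sub>R w x) \<longlonglongrightarrow> (LINT x|lebesgue. indicator {s<..t} x *\<^sub>R w x)"
  proof (rule integral_dominated_convergence[where w = "\<lambda>x. norm (indicator {s..t+1} x *\<^sub>R w x)"])
    show "(\<lambda>x. indicator {s<..t} x *\<^sub>R w x) \<in> borel_measurable lebesgue"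
      using w by (intro borel_measurable_scaleR borel_measurable_indicator) auto
    show "(\<lambda>x. \<phi> n x *\<^sub>R w x) \<in> borel_measurable lebesgue" for n
      by (intro borel_measurable_scaleR continuous_on_imp_lebesgue_measurable[OF \<phi>_cont] w)
    show "integrable lebesgue (\<lambda>x. norm (indicator {s..t+1} x *\<^sub>R w x))"
      using uw unfolding has_weak_deriv_def locally_L1_def set_integrable_def by (intro integrable_norm) auto
    have "\<bar>\<phi> n x\<bar> \<le> 1" for n x
      using H(8,9)[of "real (Suc n) * (x - s)"] H(8,9)[of "real (Suc n) * (x - t)"] unfolding \<phi>_def by linarith
    then have "\<bar>\<phi> n x\<bar> * norm (w x) \<le> 1 * norm (w x)" for n x by (intro mult_right_mono) auto
    then show "AE x in lebesgue. norm (\<phi> n x *\<^sub>R w x) \<le> norm (indicator {s..t+1} x *\<^sub>R w x)" for n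
      using \<phi>_zero by (intro AE_I2) (auto simp: indicator_def)
    \<comment> \<open>At \<open>x = r\<close> every term is \<open>H 0 = 0\<close>; this is why the
      limiting interval is open at \<open>s\<close> and closed at \<open>t\<close>.\<close>
    have H_lim: "(\<lambda>n. H (real (Suc n) * (x - r))) \<longlonglongrightarrow> (if r < x then 1 else 0)" for x r
    proof (cases "r < x")
      case True
      obtain k :: nat where k: "1 / (x - r) \<le> real k" using real_arch_simple by blast
      have "1 \<le> real (Suc n) * (x - r)" if "n \<ge> k" for n
      proof -
        have "1 / (x - r) \<le> real (Suc n)" using k that by linarith
        then show ?thesis using True by (simp add: field_simps)
      qed
      then have "eventually (\<lambda>n. H (real (Suc n) * (x - r)) = 1) sequentially"
        using H(7) by (auto simp: eventually_sequentially simp del: of_nat_Suc)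
      then show ?thesis using True by (simp add: tendsto_eventually)
    next
      case False
      then have "real (Suc n) * (x - r) \<le> 0" for n by (simp add: mult_le_0_iff)
      then show ?thesis using False H(6) by simp
    qed
    show "AE x in lebesgue. (\<lambda>n. \<phi> n x *\<^sub>R w x) \<longlonglongrightarrow> indicator {s<..t} x *\<^sub>R w x"
    proof (intro AE_I2 tendsto_scaleR tendsto_const)
      fix x
      have "(\<lambda>n. \<phi> n x) \<longlonglongrightarrow> (if s < x then 1 else 0) - (if t < x then 1 else 0)"
        unfolding \<phi>_def by (intro tendsto_diff H_lim)
      also have "(if s < x then 1 else 0) - (if t < x then 1 else 0) = (indicator {s<..t} x :: real)"
        using st by (auto simp: indicator_def)
      finally show "(\<lambda>n. \<phi> n x) \<longlonglongrightarrow> indicator {s<..t} x" .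
    qed
  qed
  from LIMSEQ_unique[OF lim1 this] show ?thesis by (simp add: set_lebesgue_integral_def)
qed

text \<open>A chord is no longer than its arc. The interval can be taken open because the end point
  \<open>t\<close> is a null set; openness matters later, when only the interior of a crossing
  interval is controlled.\<close>

lemma weak_deriv_norm_le:
  assumes uw: "has_weak_deriv u w" and v: "continuous_on UNIV v" and ae: "AE x in lebesgue. v x = u x"
    and st: "s \<le> t"
  shows "ennreal (norm (v t - v s)) \<le> emeasure (density lebesgue (\<lambda>x. ennreal (norm (w x)))) {s<..<t}"
proof -
  have w: "w \<in> borel_measurable lebesgue"
    using uw locally_L1_measurable by (auto simp: has_weak_deriv_def)
  have "ennreal (norm (v t - v s)) \<le> (\<integral>\<^sup>+ x. norm (indicator {s<..t} x *\<^sub>R w x) \<partial>lebesgue)"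
    unfolding weak_deriv_FTC[OF assms] set_lebesgue_integral_def
    by (rule integral_norm_bound_ennreal)
      (rule set_integrable_subset[of lebesgue "{s..t}" w "{s<..t}", unfolded set_integrable_def],
        use uw in \<open>auto simp: has_weak_deriv_def locally_L1_def set_integrable_def\<close>)
  also have "\<dots> = (\<integral>\<^sup>+ x. ennreal (norm (w x)) * indicator {s<..<t} x \<partial>lebesgue)"
  proof (rule nn_integral_cong_AE)
    have "AE x in lebesgue. x \<noteq> t" by (rule AE_completion) (rule AE_lborel_singleton)
    then show "AE x in lebesgue. ennreal (norm (indicator {s<..t} x *\<^sub>R w x)) = ennreal (norm (w x)) * indicator {s<..<t} x"
      by eventually_elim (auto simp: indicator_def)
  qed
  also have "\<dots> = emeasure (density lebesgue (\<lambda>x. ennreal (norm (w x)))) {s<..<t}"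
    using w by (subst emeasure_density) auto
  finally show ?thesis .
qed

section \<open>Comparison of measures\<close>

text \<open>Take \<open>t\<close> as the first time \<open>p\<close> is at least \<open>b\<close>
  and \<open>s\<close> as the last time before \<open>t\<close> when \<open>p\<close> is at most
  \<open>a\<close>; strictly between them \<open>p\<close> can do neither.\<close>

lemma crossing_interval_exists:
  fixes p :: "real \<Rightarrow> real"
  assumes p: "continuous_on {x..y} p" and xy: "x \<le> y" and ab: "p x \<le> a" "a < b" "b \<le> p y"
  obtains s t where "x \<le> s" "s < t" "t \<le> y" "p s = a" "p t = b" "\<And>r. r \<in> {s<..<t} \<Longrightarrow> p r \<in> {a<..<b}"
proof -
  have "compact ({x..y} \<inter> p -` {b..})" "{x..y} \<inter> p -` {b..} \<noteq> {}"
    using p xy ab by (auto simp: compact_eq_bounded_closed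
        intro!: continuous_closed_preimage bounded_Int)
  then obtain t where t: "t \<in> {x..y}" "b \<le> p t" "\<And>r. r \<in> {x..y} \<Longrightarrow> b \<le> p r \<Longrightarrow> t \<le> r"
    using compact_attains_inf[of "{x..y} \<inter> p -` {b..}"] by (metis IntD1 IntD2 IntI atLeast_iff vimageE vimageI)
  have cont_t: "continuous_on {x..t} p" using p t(1) by (auto intro: continuous_on_subset)
  \<comment> \<open>By the intermediate value theorem \<open>b\<close> is attained no later than
    \<open>t\<close>, and \<open>t\<close> is the first time of being at least
    \<open>b\<close>.\<close>
  have pt: "p t = b"
  proof -
    obtain r where "x \<le> r" "r \<le> t" "p r = b"
      using IVT'[of p x b t] cont_t t(1,2) ab by auto
    then show ?thesis using t(1) t(3)[of r] by auto
  qed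
  have "compact ({x..t} \<inter> p -` {..a})" "{x..t} \<inter> p -` {..a} \<noteq> {}"
    using cont_t t(1) ab by (auto simp: compact_eq_bounded_closed
        intro!: continuous_closed_preimage bounded_Int)
  then obtain s where s: "s \<in> {x..t}" "p s \<le> a" "\<And>r. r \<in> {x..t} \<Longrightarrow> p r \<le> a \<Longrightarrow> r \<le> s"
    using compact_attains_sup[of "{x..t} \<inter> p -` {..a}"] by (metis IntD1 IntD2 IntI atMost_iff vimageE vimageI)
  have ps: "p s = a"
  proof -
    have "continuous_on {s..t} p" using cont_t s(1) by (auto intro: continuous_on_subset)
    then obtain r where "s \<le> r" "r \<le> t" "p r = a"
      using IVT'[of p s a t] s(1,2) pt ab by auto
    then show ?thesis using s(1) s(3)[of r] by auto
  qed
  have "s \<noteq> t" using ps pt ab by auto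
  show ?thesis
  proof (rule that[OF _ _ _ ps pt])
    show "x \<le> s" "s < t" "t \<le> y" using s(1) t(1) \<open>s \<noteq> t\<close> by auto
    show "p r \<in> {a<..<b}" if "r \<in> {s<..<t}" for r
      using that s(1) s(3)[of r] t(1) t(3)[of r] by force
  qed
qed

text \<open>The end points are the infimum and supremum: openness keeps them out of
  \<open>C\<close>, connectedness fills everything between.\<close>

lemma open_connected_bounded_eq_interval:
  fixes C :: "real set"
  assumes C: "open C" "connected C" "C \<noteq> {}" and C_sub: "C \<subseteq> {l<..<u}"
  obtains a b where "C = {a<..<b}" "l \<le> a" "a < b" "b \<le> u"
proof -
  have bdd: "bdd_below C" "bdd_above C"
    using C_sub bdd_below_mono[of "{l<..<u}" C] bdd_above_mono[of "{l<..<u}" C] by auto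
  have sub: "C \<subseteq> {Inf C<..<Sup C}"
  proof
    fix x assume "x \<in> C"
    then obtain e where e: "e > 0" "ball x e \<subseteq> C" using C(1) open_contains_ball by blast
    then have "x - e/2 \<in> C" "x + e/2 \<in> C" by (auto simp: dist_real_def subset_iff)
    then have "Inf C \<le> x - e/2" "x + e/2 \<le> Sup C"
      using bdd by (auto intro: cInf_lower cSup_upper)
    with e(1) show "x \<in> {Inf C<..<Sup C}" by auto
  qed
  moreover have "{Inf C<..<Sup C} \<subseteq> C"
  proof
    fix y assume "y \<in> {Inf C<..<Sup C}"
    then obtain c d where "c \<in> C" "c < y" "d \<in> C" "y < d"
      using bdd C(3) by (auto simp: cInf_less_iff less_cSup_iff)
    then show "y \<in> C" using connectedD_interval[OF C(2), of c d y] by auto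
  qed
  ultimately have "C = {Inf C<..<Sup C}" by blast
  moreover have "l \<le> Inf C" using C(3) C_sub by (auto intro!: cInf_greatest)
  moreover have "Inf C < Sup C" using sub C(3) by fastforce
  moreover have "Sup C \<le> u" using C(3) C_sub by (auto intro!: cSup_least)
  ultimately show ?thesis by (rule that)
qed

text \<open>An open set is the countable disjoint union of its components, which are intervals, so
  the bound passes to open sets; outer regularity of the finite measure \<open>N\<close> carries it
  to Borel sets.\<close>

lemma emeasure_ge_of_intervals:
  fixes N :: "real measure" and c :: ennreal
  assumes fin: "emeasure N (space N) \<noteq> \<infinity>" and sets: "sets N = sets borel"
    and int: "\<And>a b. l \<le> a \<Longrightarrow> a < b \<Longrightarrow> b \<le> u \<Longrightarrow> c * ennreal (b - a) \<le> emeasure N {a<..<b}"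
    and B: "B \<in> sets borel" "B \<subseteq> {l<..<u}"
  shows "c * emeasure lborel B \<le> emeasure N B"
proof -
  have op: "c * emeasure lborel U \<le> emeasure N U" if U: "open U" "U \<subseteq> {l<..<u}" for U
  proof -
    have comp_open: "open C" if "C \<in> components U" for C using open_components U(1) that by blast
    have cnt: "countable (components U)"
      using comp_open pairwise_disjoint_components[of U] by (intro countable_disjoint_open_subsets)
        (simp_all add: disjnt_def[abs_def])
    have disj: "disjoint_family_on (\<lambda>C. C) (components U)"
      using pairwise_disjoint_components[of U] by (auto simp: disjoint_family_on_def pairwise_def disjnt_def)
    have U_eq: "U = (\<Union>C\<in>components U. C)" using Union_components[of U] by simp
    have comp: "c * emeasure lborel C \<le> emeasure N C" if "C \<in> components U" for C
    proof -
      obtain a b where "C = {a<..<b}" "l \<le> a" "a < b" "b \<le> u"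
        using open_connected_bounded_eq_interval[of C l u] comp_open[of C] \<open>C \<in> components U\<close> U(2)
          in_components_connected in_components_nonempty in_components_subset by blast
      then show ?thesis using int[of a b] by simp
    qed
    have "c * emeasure lborel U = c * (\<integral>\<^sup>+ C. emeasure lborel C \<partial>count_space (components U))"
      using comp_open cnt disj by (subst (1) U_eq, subst emeasure_UN_countable) auto
    also have "\<dots> = (\<integral>\<^sup>+ C. c * emeasure lborel C \<partial>count_space (components U))"
      by (rule nn_integral_cmult[symmetric]) simp
    also have "\<dots> \<le> (\<integral>\<^sup>+ C. emeasure N C \<partial>count_space (components U))"
      using comp by (intro nn_integral_mono) auto
    also have "\<dots> = emeasure N U"
      using comp_open cnt disj sets by (subst (2) U_eq, subst emeasure_UN_countable) auto
    finally show ?thesis .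
  qed
  \<comment> \<open>An open superset of \<open>B\<close> may leave \<open>{l<..<u}\<close>, so it is
    cut down first; this loses nothing of \<open>B\<close>.\<close>
  have "c * emeasure lborel B \<le> emeasure N U" if "B \<subseteq> U" "open U" for U
  proof -
    have "c * emeasure lborel B \<le> c * emeasure lborel (U \<inter> {l<..<u})"
      using that B by (intro mult_left_mono emeasure_mono) auto
    also have "\<dots> \<le> emeasure N (U \<inter> {l<..<u})" using that by (intro op) auto
    also have "\<dots> \<le> emeasure N U" using that sets by (intro emeasure_mono) auto
    finally show ?thesis .
  qed
  then show ?thesis
    unfolding outer_regular[OF sets fin B(1)] by (intro INF_greatest) auto
qed

text \<open>In the application \<open>\<mu>\<close> is the arc length measure of a curve and \<open>f\<close>, \<open>k\<close> are the distances to
  two sets at distance \<open>D\<close>. The factor 2 arises because the curve crosses every level below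
  \<open>D / 2\<close> once while it leaves the first set and once more while it approaches the second.\<close>

lemma emeasure_distr_min_ge:
  fixes \<mu> :: "real measure" and f k :: "real \<Rightarrow> real"
  assumes sets: "sets \<mu> = sets lebesgue" and fin: "\<And>n::nat. emeasure \<mu> {- real n..real n} < \<infinity>"
    and f: "continuous_on UNIV f" "\<And>s t. s \<le> t \<Longrightarrow> ennreal \<bar>f t - f s\<bar> \<le> emeasure \<mu> {s<..<t}"
    and k: "continuous_on UNIV k" "\<And>s t. s \<le> t \<Longrightarrow> ennreal \<bar>k t - k s\<bar> \<le> emeasure \<mu> {s<..<t}"
    and fk: "\<And>x. D \<le> f x + k x" and lim: "(f \<longlongrightarrow> 0) at_bot" "(k \<longlongrightarrow> 0) at_top"
    and B: "B \<in> sets borel" "B \<subseteq> {0<..<D/2}"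
  shows "2 * emeasure lborel B \<le> emeasure (distr \<mu> borel (\<lambda>x. min (f x) (k x))) B"
proof -
  define m where "m x = min (f x) (k x)" for x
  have "continuous_on UNIV m" unfolding m_def by (intro continuous_intros f k)
  then have m_leb: "m \<in> borel_measurable lebesgue"
    by (intro measurable_completion) (simp add: borel_measurable_continuous_onI)
  then have m: "m \<in> borel_measurable \<mu>" using measurable_cong_sets[OF sets refl] by blast
  have sp: "space \<mu> = UNIV" using sets_eq_imp_space_eq[OF sets] by simp
  \<comment> \<open>As \<open>f\<close> and \<open>k\<close> merely tend to 0, low levels may be
    missed on a bounded interval. Levels above \<open>\<epsilon>\<close> are all crossed inside some
    \<open>K\<close>, and there \<open>\<mu>\<close> is finite, as outer regularity
    requires.\<close>
  have away: "2 * emeasure lborel B' \<le> emeasure (distr \<mu> borel m) B'"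
    if "\<epsilon> > 0" and B': "B' \<in> sets borel" "B' \<subseteq> {\<epsilon><..<D/2}" for \<epsilon> B'
  proof -
    have "\<forall>\<^sub>F x in at_bot. f x < \<epsilon>" "\<forall>\<^sub>F x in at_top. k x < \<epsilon>"
      using lim \<open>\<epsilon> > 0\<close> by (auto intro: order_tendstoD)
    then obtain x0 y0 where x0: "\<And>x. x \<le> x0 \<Longrightarrow> f x < \<epsilon>" and y0: "\<And>x. x \<ge> y0 \<Longrightarrow> k x < \<epsilon>"
      by (auto simp: eventually_at_bot_linorder eventually_at_top_linorder)
    obtain n :: nat where "max (- x0) y0 \<le> real n" using real_arch_simple by blast
    then have fn: "f (- real n) < \<epsilon>" and kn: "k (real n) < \<epsilon>" using x0 y0 by auto
    define K where "K = {- real n..real n}"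
    have K: "K \<in> sets \<mu>" unfolding sets K_def by simp
    define N where "N = distr (density \<mu> (indicator K)) borel m"
    have N: "emeasure N A = emeasure \<mu> (K \<inter> m -` A)" if "A \<in> sets borel" for A
    proof -
      have mA: "m -` A \<in> sets \<mu>" using measurable_sets[OF m that] sp by simp
      have "emeasure N A = emeasure (density \<mu> (indicator K)) (m -` A)"
        unfolding N_def using m that sp by (subst emeasure_distr) auto
      also have "\<dots> = (\<integral>\<^sup>+ x. indicator (K \<inter> m -` A) x \<partial>\<mu>)"
        using K mA by (subst emeasure_density) (auto intro!: nn_integral_cong borel_measurable_indicator simp only: indicator_inter_arith)
      also have "\<dots> = emeasure \<mu> (K \<inter> m -` A)" using K mA by (intro nn_integral_indicator) auto
      finally show ?thesis .
    qed
    have int: "2 * ennreal (b - a) \<le> emeasure N {a<..<b}" if ab: "\<epsilon> \<le> a" "a < b" "b \<le> D/2" for a b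
    proof -
      \<comment> \<open>At the right end \<open>k\<close> is below \<open>a < D/2\<close>, so
        \<open>f\<close> is above \<open>D/2 \<ge> b\<close>.\<close>
      have fab: "f (- real n) \<le> a" "b \<le> f (real n)" using fn kn ab fk[of "real n"] by linarith+
      have n: "- real n \<le> real n" by simp
      obtain s t where st: "- real n \<le> s" "s < t" "t \<le> real n" "f s = a" "f t = b"
        "\<And>r. r \<in> {s<..<t} \<Longrightarrow> f r \<in> {a<..<b}"
        using crossing_interval_exists[OF continuous_on_subset[OF f(1) subset_UNIV] n fab(1) ab(2) fab(2)]
        by metis
      \<comment> \<open>\<open>k\<close> has to come down from \<open>b\<close> to \<open>a\<close>,
        so the upward crossing lemma is applied to its negative.\<close>
      have kab: "- k (- real n) \<le> - b" "- b < - a" "- a \<le> - k (real n)" using fn kn ab fk[of "- real n"] by linarith+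
      obtain s' t' where st': "- real n \<le> s'" "s' < t'" "t' \<le> real n" "- k s' = - b" "- k t' = - a"
        "\<And>r. r \<in> {s'<..<t'} \<Longrightarrow> - k r \<in> {- b<..<- a}"
        using crossing_interval_exists[OF continuous_on_subset[OF continuous_on_minus[OF k(1)] subset_UNIV] n kab]
        by metis
      have "2 * ennreal (b - a) = ennreal \<bar>f t - f s\<bar> + ennreal \<bar>k t' - k s'\<bar>"
        using st st' ab by (simp add: mult_2)
      also have "\<dots> \<le> emeasure \<mu> {s<..<t} + emeasure \<mu> {s'<..<t'}"
        using st st' by (intro add_mono f k) auto
      also have "\<dots> = emeasure \<mu> ({s<..<t} \<union> {s'<..<t'})"
      proof (rule plus_emeasure)
        \<comment> \<open>At a common point both distances would be below
          \<open>b \<le> D/2\<close>, contradicting that their sum is at least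
          \<open>D\<close>.\<close>
        show "{s<..<t} \<inter> {s'<..<t'} = {}"
        proof (rule ccontr)
          assume "{s<..<t} \<inter> {s'<..<t'} \<noteq> {}"
          then obtain r where "r \<in> {s<..<t}" "r \<in> {s'<..<t'}" by blast
          then show False using st(6)[of r] st'(6)[of r] fk[of r] ab by auto
        qed
      qed (simp_all add: sets)
      also have "\<dots> \<le> emeasure \<mu> (K \<inter> m -` {a<..<b})"
      proof (rule emeasure_mono)
        show "{s<..<t} \<union> {s'<..<t'} \<subseteq> K \<inter> m -` {a<..<b}"
        proof
          fix r assume r: "r \<in> {s<..<t} \<union> {s'<..<t'}"
          then have "r \<in> K" using st st' by (auto simp: K_def)
          moreover have "f r \<in> {a<..<b} \<or> k r \<in> {a<..<b}" using r st(6)[of r] st'(6)[of r] by auto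
          \<comment> \<open>If one distance is below \<open>b \<le> D/2\<close>, the other exceeds
            \<open>D/2\<close>, so the small one is the minimum.\<close>
          then have "m r \<in> {a<..<b}" using fk[of r] ab by (auto simp: m_def min_def)
          ultimately show "r \<in> K \<inter> m -` {a<..<b}" by simp
        qed
        show "K \<inter> m -` {a<..<b} \<in> sets \<mu>"
          using K measurable_sets[OF m, of "{a<..<b}"] sp by auto
      qed
      also have "\<dots> = emeasure N {a<..<b}" by (subst N) auto
      finally show ?thesis .
    qed
    have "2 * emeasure lborel B' \<le> emeasure N B'"
    proof (rule emeasure_ge_of_intervals[OF _ _ int B'])
      have "emeasure N (space N) = emeasure \<mu> K" using N[of UNIV] by (simp add: N_def)
      then show "emeasure N (space N) \<noteq> \<infinity>" using fin[of n] by (simp add: K_def)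
      show "sets N = sets borel" by (simp add: N_def)
    qed
    also have "\<dots> \<le> emeasure \<mu> (m -` B')"
      using measurable_sets[OF m B'(1)] sp by (subst N[OF B'(1)]) (auto intro!: emeasure_mono)
    also have "\<dots> = emeasure (distr \<mu> borel m) B'"
      using m B'(1) sp by (subst emeasure_distr) auto
    finally show ?thesis .
  qed
  \<comment> \<open>Exhausting \<open>B\<close> by parts bounded away from 0 removes the lower bound
    \<open>\<epsilon>\<close> on the levels.\<close>
  define A where "A n = B \<inter> {1 / real (Suc n)<..}" for n
  have "x \<in> (\<Union>n. A n)" if "x \<in> B" for x
  proof -
    have "x > 0" using that B(2) by auto
    then obtain n where "1 / real (Suc n) < x" using nat_approx_posE by blast
    then show ?thesis using that by (auto simp: A_def)
  qed
  then have A_UN: "(\<Union>n. A n) = B" by (auto simp: A_def)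
  have "incseq A"
    unfolding A_def by (intro monoI Int_mono order_refl) (auto simp: field_simps intro: le_less_trans[rotated] frac_le)
  then have "(\<lambda>n. emeasure lborel (A n)) \<longlonglongrightarrow> emeasure lborel (\<Union>n. A n)"
    by (rule Lim_emeasure_incseq[rotated]) (use B(1) in \<open>auto simp: A_def\<close>)
  then have "(\<lambda>n. 2 * emeasure lborel (A n)) \<longlonglongrightarrow> 2 * emeasure lborel B"
    unfolding A_UN by (intro ennreal_tendsto_cmult) auto
  moreover have "2 * emeasure lborel (A n) \<le> emeasure (distr \<mu> borel m) B" for n
  proof -
    have "2 * emeasure lborel (A n) \<le> emeasure (distr \<mu> borel m) (A n)"
      using B by (intro away[of "1 / real (Suc n)"]) (auto simp: A_def)
    also have "\<dots> \<le> emeasure (distr \<mu> borel m) B"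
      using B by (intro emeasure_mono) (auto simp: A_def)
    finally show ?thesis .
  qed
  ultimately have "2 * emeasure lborel B \<le> emeasure (distr \<mu> borel m) B"
    by (intro LIMSEQ_le_const2) auto
  then show ?thesis by (simp add: m_def[abs_def])
qed

text \<open>On every \<open>B\<close> and on its complement the integral over \<open>M\<close> is at
  most that over \<open>N\<close>; equal finite totals leave no room for strictness. Thus
  \<open>h\<close> gives both measures the same density measure, and on \<open>A\<close> one can
  divide by \<open>h\<close>.\<close>

lemma emeasure_eq_of_nn_integral_eq:
  fixes h :: "'a \<Rightarrow> ennreal"
  assumes sets[measurable_cong]: "sets M = sets N" and le: "M \<le> N"
    and h[measurable]: "h \<in> borel_measurable M"
    and eq: "(\<integral>\<^sup>+ x. h x \<partial>M) = (\<integral>\<^sup>+ x. h x \<partial>N)" and fin: "(\<integral>\<^sup>+ x. h x \<partial>N) \<noteq> \<infinity>"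
    and A[measurable]: "A \<in> sets M" and pos: "\<And>x. x \<in> A \<Longrightarrow> 0 < h x \<and> h x < \<infinity>"
  shows "emeasure M A = emeasure N A"
proof -
  have hN[measurable]: "h \<in> borel_measurable N" using h measurable_cong_sets[OF sets refl] by blast
  have dens: "density M h = density N h"
  proof (rule measure_eqI)
    fix B assume "B \<in> sets (density M h)"
    then have B[measurable]: "B \<in> sets M" by simp
    then have BN: "B \<in> sets N" using sets by simp
    have split: "(\<integral>\<^sup>+ x. h x \<partial>L) = (\<integral>\<^sup>+ x. h x * indicator B x \<partial>L) + (\<integral>\<^sup>+ x. h x * indicator (- B) x \<partial>L)"
      if [measurable_cong]: "sets L = sets M" for L
    proof -
      have [measurable]: "h \<in> borel_measurable L" "B \<in> sets L"
        using h B that measurable_cong_sets[OF that refl] by auto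
      have "(\<integral>\<^sup>+ x. h x \<partial>L) = (\<integral>\<^sup>+ x. h x * indicator B x + h x * indicator (- B) x \<partial>L)"
        by (intro nn_integral_cong) (auto simp: indicator_def)
      also have "\<dots> = (\<integral>\<^sup>+ x. h x * indicator B x \<partial>L) + (\<integral>\<^sup>+ x. h x * indicator (- B) x \<partial>L)"
        by (intro nn_integral_add) auto
      finally show ?thesis .
    qed
    have le1: "(\<integral>\<^sup>+ x. h x * indicator B x \<partial>M) \<le> (\<integral>\<^sup>+ x. h x * indicator B x \<partial>N)"
      and le2: "(\<integral>\<^sup>+ x. h x * indicator (- B) x \<partial>M) \<le> (\<integral>\<^sup>+ x. h x * indicator (- B) x \<partial>N)"
      by (intro nn_integral_mono_measure sets le)+
    \<comment> \<open>Finiteness is what allows the integral over the complement to be cancelled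
      below.\<close>
    have fin2: "(\<integral>\<^sup>+ x. h x * indicator (- B) x \<partial>N) \<noteq> \<infinity>"
      using fin split[of N] sets by auto
    have "(\<integral>\<^sup>+ x. h x * indicator B x \<partial>N) + (\<integral>\<^sup>+ x. h x * indicator (- B) x \<partial>N)
       \<le> (\<integral>\<^sup>+ x. h x * indicator B x \<partial>M) + (\<integral>\<^sup>+ x. h x * indicator (- B) x \<partial>N)"
      using eq add_left_mono[OF le2, of "\<integral>\<^sup>+ x. h x * indicator B x \<partial>M"] by (simp only: split[OF sets[symmetric]] split[OF refl])
    then have "(\<integral>\<^sup>+ x. h x * indicator B x \<partial>N) \<le> (\<integral>\<^sup>+ x. h x * indicator B x \<partial>M)"
      using fin2 unfolding add.commute[of _ "\<integral>\<^sup>+ x. h x * indicator (- B) x \<partial>N"] ennreal_add_left_cancel_le by simp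
    with le1 show "emeasure (density M h) B = emeasure (density N h) B"
      using B BN by (simp add: emeasure_density)
  qed (simp add: sets)
  have "emeasure L A = (\<integral>\<^sup>+ x. inverse (h x) * indicator A x \<partial>density L h)"
    if sL: "sets L = sets M" for L
  proof -
    have [measurable]: "h \<in> borel_measurable L" "A \<in> sets L"
      using h A sL measurable_cong_sets[OF sL refl] by auto
    have "(\<integral>\<^sup>+ x. inverse (h x) * indicator A x \<partial>density L h) = (\<integral>\<^sup>+ x. h x * (inverse (h x) * indicator A x) \<partial>L)"
      by (intro nn_integral_density) auto
    also have "\<dots> = (\<integral>\<^sup>+ x. indicator A x \<partial>L)"
    proof (intro nn_integral_cong)
      fix x
      have "h x * inverse (h x) = 1" if "x \<in> A"
        using pos[OF that] ennreal_divide_self[of "h x"] by (simp add: divide_ennreal_def less_le)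
      then show "h x * (inverse (h x) * indicator A x) = indicator A x"
        by (auto simp: indicator_def)
    qed
    finally show ?thesis by simp
  qed
  then show ?thesis using dens sets by metis
qed

section \<open>Rigidity of curves of least energy\<close>

text \<open>The set of disagreement is open and negligible, hence empty. This identifies the
  continuous representatives that the limits at the two ends supply separately.\<close>

lemma continuous_AE_eq_imp_eq:
  fixes f g :: "'a::euclidean_space \<Rightarrow> 'b::t2_space"
  assumes f: "continuous_on UNIV f" and g: "continuous_on UNIV g" and ae: "AE x in lebesgue. f x = g x"
  shows "f = g"
proof (rule ccontr)
  assume "f \<noteq> g"
  then have "{x. f x \<noteq> g x} \<noteq> {}" by auto
  moreover have "open {x. f x \<noteq> g x}" by (intro open_Collect_neq f g)
  moreover have "negligible {x. f x \<noteq> g x}"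
    using ae \<open>open {x. f x \<noteq> g x}\<close> by (simp add: negligible_iff_null_sets AE_iff_null_sets)
  ultimately show False using open_not_negligible by blast
qed

lemma two_mult_sqrt_le:
  fixes x y c :: real
  assumes "0 \<le> x" "0 \<le> y" "y \<le> c"
  shows "2 * (x * sqrt y) \<le> x\<^sup>2 + c"
proof -
  have "0 \<le> (x - sqrt y)\<^sup>2" by simp
  then show ?thesis using assms by (simp add: power2_diff)
qed

theorem proposition12:
  fixes Sm Sp :: "'a::euclidean_space set"
    and D :: real and \<rho> W :: "'a \<Rightarrow> real" and g :: "real \<Rightarrow> real"
    and Am Ap :: 'a and \<Psi> :: "real \<Rightarrow> 'a"
  assumes "compact Sm" and "Sm \<noteq> {}"
    and "compact Sp" and "Sp \<noteq> {}"
    and "Sm \<inter> Sp = {}"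
    and D: "D = setdist Sm Sp"
    and \<rho>: "\<And>q. \<rho> q = min (infdist q Sm) (infdist q Sp)"
    and "continuous_on UNIV W" and "\<And>q. W q \<ge> 0"
    and "g \<in> borel_measurable (restrict_space borel {0..<D/2})"
    and "\<And>s. s \<in> {0..<D/2} \<Longrightarrow> g s \<ge> 0"
    and "locally_bounded_on {0..<D/2} g"
    and "\<And>q. \<rho> q < D/2 \<Longrightarrow> W q \<ge> g (\<rho> q)"
    and "W -` {0} = Sm \<union> Sp"
    and "\<And>s. 0 < s \<Longrightarrow> s < D/2 \<Longrightarrow> g s > 0"
    and "Am \<in> Sm" and "Ap \<in> Sp"
    and "\<Psi> \<in> H1_loc"
    and "energy W \<Psi> < \<infinity>"
    and "cont_rep_tendsto \<Psi> Am at_bot"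
    and "cont_rep_tendsto \<Psi> Ap at_top"
    and "energy W \<Psi> = 4 * (\<integral>\<^sup>+ s\<in>{0..<D/2}. ennreal (sqrt (g s)) \<partial>lborel)"
  shows "norm (Ap - Am) = D"
proof (rule antisym)
  note W_cont = assms(8) and W_nonneg = assms(9) and g_meas = assms(10) and W_ge = assms(13)
    and g_pos = assms(15) and Am = assms(16) and Ap = assms(17)
    and E_fin = assms(19) and E_eq = assms(22)
  show "D \<le> norm (Ap - Am)"
    using setdist_le_dist[OF Am Ap] by (simp add: D dist_norm norm_minus_commute)

  \<comment> \<open>The curve and its arc length measure\<close>
  define w where "w = weak_deriv \<Psi>"
  have weak: "has_weak_deriv \<Psi> w"
    using assms(18) unfolding w_def weak_deriv_def H1_loc_def by (auto intro: someI[of "has_weak_deriv \<Psi>"])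
  obtain v where v: "continuous_on UNIV v" "AE x in lebesgue. v x = \<Psi> x"
    and v_bot: "(v \<longlongrightarrow> Am) at_bot" and v_top: "(v \<longlongrightarrow> Ap) at_top"
  proof -
    obtain v where v: "continuous_on UNIV v" "AE x in lebesgue. v x = \<Psi> x" "(v \<longlongrightarrow> Am) at_bot"
      using assms(20) unfolding cont_rep_tendsto_def by blast
    obtain v' where v': "continuous_on UNIV v'" "AE x in lebesgue. v' x = \<Psi> x" "(v' \<longlongrightarrow> Ap) at_top"
      using assms(21) unfolding cont_rep_tendsto_def by blast
    have "AE x in lebesgue. v x = v' x" using v(2) v'(2) by eventually_elim simp
    with v v' have "v = v'" by (intro continuous_AE_eq_imp_eq)
    with v v' show ?thesis by (auto intro: that)
  qed
  have w_meas[measurable]: "w \<in> borel_measurable lebesgue"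
    using weak locally_L1_measurable by (auto simp: has_weak_deriv_def)
  define \<mu> where "\<mu> = density lebesgue (\<lambda>x. ennreal (norm (w x)))"
  have \<mu>_sets[measurable_cong]: "sets \<mu> = sets lebesgue" and \<mu>_space: "space \<mu> = UNIV" by (simp_all add: \<mu>_def)
  have v_le: "ennreal (norm (v t - v s)) \<le> emeasure \<mu> {s<..<t}" if "s \<le> t" for s t
    unfolding \<mu>_def by (rule weak_deriv_norm_le[OF weak v that])
  define m where "m x = min (infdist (v x) Sm) (infdist (v x) Sp)" for x
  have m_eq: "m x = \<rho> (v x)" for x by (simp add: m_def \<rho>)
  have "continuous_on UNIV m" unfolding m_def by (intro continuous_intros v)
  then have m_meas[measurable]: "m \<in> borel_measurable lebesgue"
    by (rule continuous_on_imp_lebesgue_measurable)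
  have m_meas'[measurable]: "m \<in> borel_measurable \<mu>" using measurable_cong_sets[OF \<mu>_sets refl] m_meas by blast
  define N where "N = distr \<mu> borel m"
  define I where "I = {0<..<D/2}"
  have I[measurable]: "I \<in> sets borel" by (simp add: I_def)
  have N_ge: "2 * emeasure lborel B \<le> emeasure N B" if "B \<in> sets borel" "B \<subseteq> I" for B
    unfolding N_def m_def[abs_def]
  proof (rule emeasure_distr_min_ge[OF \<mu>_sets, where D = D])
    show "emeasure \<mu> {- real n..real n} < \<infinity>" for n
    proof -
      \<comment> \<open>Local integrability gives finite length on bounded intervals only;
        finiteness of the total length comes out at the end.\<close>
      have "set_integrable lebesgue {- real n..real n} w"
        using weak by (auto simp: has_weak_deriv_def locally_L1_def)
      then have "(\<integral>\<^sup>+ x. norm (indicator {- real n..real n} x *\<^sub>R w x) \<partial>lebesgue) < \<infinity>"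
        by (simp add: set_integrable_def integrable_iff_bounded)
      also have "(\<integral>\<^sup>+ x. norm (indicator {- real n..real n} x *\<^sub>R w x) \<partial>lebesgue) = emeasure \<mu> {- real n..real n}"
        unfolding \<mu>_def by (subst emeasure_density) (auto intro!: nn_integral_cong simp: indicator_def)
      finally show ?thesis .
    qed
    show "continuous_on UNIV (\<lambda>x. infdist (v x) Sm)" "continuous_on UNIV (\<lambda>x. infdist (v x) Sp)"
      by (intro continuous_intros v)+
    have infdist_le: "ennreal \<bar>infdist (v t) S - infdist (v s) S\<bar> \<le> emeasure \<mu> {s<..<t}" if "s \<le> t" for s t S
      using infdist_triangle_abs[of "v t" S "v s"]
      by (intro order_trans[OF _ v_le[OF that]] ennreal_leI) (simp add: dist_norm)
    show "ennreal \<bar>infdist (v t) Sm - infdist (v s) Sm\<bar> \<le> emeasure \<mu> {s<..<t}"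
      and "ennreal \<bar>infdist (v t) Sp - infdist (v s) Sp\<bar> \<le> emeasure \<mu> {s<..<t}" if "s \<le> t" for s t
      using that by (rule infdist_le)+
    show "D \<le> infdist (v x) Sm + infdist (v x) Sp" for x
      using setdist_triangle[of Sm Sp "v x"] by (simp add: D infdist_eq_setdist setdist_sym)
    have "((\<lambda>x. infdist (v x) Sm) \<longlongrightarrow> infdist Am Sm) at_bot" by (intro tendsto_infdist v_bot)
    then show "((\<lambda>x. infdist (v x) Sm) \<longlongrightarrow> 0) at_bot" using Am by simp
    have "((\<lambda>x. infdist (v x) Sp) \<longlongrightarrow> infdist Ap Sp) at_top" by (intro tendsto_infdist v_top)
    then show "((\<lambda>x. infdist (v x) Sp) \<longlongrightarrow> 0) at_top" using Ap by simp
  qed (use that in \<open>simp_all add: I_def\<close>)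

  \<comment> \<open>The lower bound for the energy density\<close>
  define h where "h s = ennreal (sqrt (g s)) * indicator I s" for s
  have h_meas[measurable]: "h \<in> borel_measurable borel"
  proof -
    have "g \<in> borel_measurable (restrict_space borel I)"
      by (rule measurable_restrict_mono[OF g_meas]) (auto simp: I_def)
    then have "(\<lambda>s. ennreal (sqrt (g s))) \<in> borel_measurable (restrict_space borel I)" by measurable
    then show ?thesis
      unfolding h_def by (subst (asm) borel_measurable_restrict_space_iff_ennreal) auto
  qed
  have h_int: "energy W \<Psi> = 4 * (\<integral>\<^sup>+ s. h s \<partial>lborel)"
  proof -
    \<comment> \<open>The two domains differ by the point 0 only, a null set.\<close>
    have "(\<integral>\<^sup>+ s\<in>{0..<D/2}. ennreal (sqrt (g s)) \<partial>lborel) = (\<integral>\<^sup>+ s. h s \<partial>lborel)"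
      by (intro nn_integral_cong_AE, rule AE_mp[OF AE_lborel_singleton[of 0]])
        (auto simp: h_def I_def indicator_def)
    then show ?thesis using E_eq by simp
  qed
  define e where "e z = ennreal ((norm (w z))\<^sup>2 + W (v z))" for z
  have "(\<lambda>z. W (v z)) \<in> borel_measurable lebesgue"
    by (intro continuous_on_imp_lebesgue_measurable continuous_on_compose2[OF W_cont v(1)]) auto
  then have e_meas[measurable]: "e \<in> borel_measurable lebesgue" unfolding e_def by measurable
  have e_int: "energy W \<Psi> = (\<integral>\<^sup>+ z. e z \<partial>lebesgue)"
    unfolding energy_def w_def[symmetric] e_def
    using v(2) by (intro nn_integral_cong_AE) auto
  define q where "q z = 2 * (ennreal (norm (w z)) * h (m z))" for z
  have q_meas[measurable]: "q \<in> borel_measurable lebesgue" unfolding q_def by measurable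
  have q_le: "q z \<le> e z" for z
  proof (cases "m z \<in> I")
    case True
    then have "0 < g (m z)" "g (m z) \<le> W (v z)" using g_pos[of "m z"] W_ge[of "v z"] by (auto simp: I_def m_eq)
    then have "2 * (norm (w z) * sqrt (g (m z))) \<le> (norm (w z))\<^sup>2 + W (v z)"
      by (intro two_mult_sqrt_le) auto
    then have "ennreal (2 * (norm (w z) * sqrt (g (m z)))) \<le> e z" unfolding e_def by (rule ennreal_leI)
    also have "ennreal (2 * (norm (w z) * sqrt (g (m z)))) = q z"
      using True \<open>0 < g (m z)\<close> by (simp add: q_def h_def ennreal_mult)
    finally show ?thesis .
  qed (simp add: q_def h_def)
  \<comment> \<open>Change of variables: the factor \<open>norm (w z)\<close> is the density of
    \<open>\<mu>\<close>, whose image under \<open>m\<close> is \<open>N\<close>.\<close>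
  have q_int: "(\<integral>\<^sup>+ z. q z \<partial>lebesgue) = 2 * (\<integral>\<^sup>+ s. h s \<partial>N)"
  proof -
    have "(\<integral>\<^sup>+ z. q z \<partial>lebesgue) = 2 * (\<integral>\<^sup>+ z. ennreal (norm (w z)) * h (m z) \<partial>lebesgue)"
      unfolding q_def by (rule nn_integral_cmult) measurable
    also have "(\<integral>\<^sup>+ z. ennreal (norm (w z)) * h (m z) \<partial>lebesgue) = (\<integral>\<^sup>+ z. h (m z) \<partial>\<mu>)"
      unfolding \<mu>_def by (rule nn_integral_density[symmetric]) measurable
    also have "\<dots> = (\<integral>\<^sup>+ s. h s \<partial>N)"
      unfolding N_def by (rule nn_integral_distr[symmetric]) measurable
    finally show ?thesis .
  qed

  \<comment> \<open>Equality of the image measure with twice the Lebesgue measure\<close>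
  define L where "L = density lborel (\<lambda>s. 2 * indicator I s)"
  define N' where "N' = density N (indicator I)"
  have N_sets[measurable_cong]: "sets N = sets borel" by (simp add: N_def)
  have L_sets: "sets L = sets borel" and N'_sets: "sets N' = sets borel" by (simp_all add: L_def N'_def N_def)
  have L_em: "emeasure L B = 2 * emeasure lborel (B \<inter> I)" if [measurable]: "B \<in> sets borel" for B
  proof -
    have "emeasure L B = (\<integral>\<^sup>+ s. 2 * indicator (B \<inter> I) s \<partial>lborel)"
      unfolding L_def by (subst emeasure_density) (auto intro!: nn_integral_cong simp: indicator_def)
    then show ?thesis by (simp add: nn_integral_cmult)
  qed
  have N'_em: "emeasure N' B = emeasure N (B \<inter> I)" if [measurable]: "B \<in> sets borel" for B
  proof -
    have "emeasure N' B = (\<integral>\<^sup>+ s. indicator I s * indicator B s \<partial>N)"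
      unfolding N'_def by (rule emeasure_density) measurable
    also have "\<dots> = (\<integral>\<^sup>+ s. indicator (I \<inter> B) s \<partial>N)" by (simp only: indicator_inter_arith)
    also have "\<dots> = emeasure N (B \<inter> I)" by (subst nn_integral_indicator) (auto simp: Int_commute N_sets)
    finally show ?thesis .
  qed
  \<comment> \<open>The order on measures with the same measurable sets compares values at all sets;
    nonmeasurable ones have value 0 by convention.\<close>
  have "emeasure L B \<le> emeasure N' B" for B
  proof (cases "B \<in> sets borel")
    case True
    then show ?thesis using N_ge[of "B \<inter> I"] by (simp add: L_em N'_em)
  qed (simp add: emeasure_notin_sets L_sets N'_sets)
  then have L_le: "L \<le> N'"
    using L_sets N'_sets sets_eq_imp_space_eq[of L N'] by (simp add: le_measure_iff le_fun_def)
  have hL: "(\<integral>\<^sup>+ s. h s \<partial>L) = 2 * (\<integral>\<^sup>+ s. h s \<partial>lborel)"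
  proof -
    have "(\<integral>\<^sup>+ s. h s \<partial>L) = (\<integral>\<^sup>+ s. 2 * indicator I s * h s \<partial>lborel)"
      unfolding L_def by (rule nn_integral_density) auto
    also have "\<dots> = (\<integral>\<^sup>+ s. 2 * h s \<partial>lborel)"
      by (intro nn_integral_cong) (auto simp: h_def indicator_def)
    finally show ?thesis by (simp add: nn_integral_cmult)
  qed
  have hN': "(\<integral>\<^sup>+ s. h s \<partial>N') = (\<integral>\<^sup>+ s. h s \<partial>N)"
  proof -
    have "(\<integral>\<^sup>+ s. h s \<partial>N') = (\<integral>\<^sup>+ s. indicator I s * h s \<partial>N)"
      unfolding N'_def by (rule nn_integral_density) measurable
    also have "\<dots> = (\<integral>\<^sup>+ s. h s \<partial>N)"
      by (intro nn_integral_cong) (auto simp: h_def indicator_def)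
    finally show ?thesis .
  qed
  \<comment> \<open>This starts a closed chain: the energy is twice the integral of \<open>h\<close>
    over \<open>L\<close>, at most twice that over \<open>N'\<close>, which is the integral of
    \<open>q\<close>, at most that of \<open>e\<close>, which is again the energy. So every link is
    an equality.\<close>
  have E_L: "energy W \<Psi> = 2 * (\<integral>\<^sup>+ s. h s \<partial>L)"
    unfolding h_int hL by (simp add: mult.assoc[symmetric])
  have L_N': "(\<integral>\<^sup>+ s. h s \<partial>L) \<le> (\<integral>\<^sup>+ s. h s \<partial>N')"
    using L_le L_sets N'_sets by (intro nn_integral_mono_measure) auto
  have N'_E: "2 * (\<integral>\<^sup>+ s. h s \<partial>N') \<le> energy W \<Psi>"
    unfolding hN' q_int[symmetric] e_int by (intro nn_integral_mono q_le)
  have q_E: "(\<integral>\<^sup>+ z. q z \<partial>lebesgue) = (\<integral>\<^sup>+ z. e z \<partial>lebesgue)"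
    using N'_E mult_left_mono[OF L_N', of 2] unfolding hN' q_int[symmetric] E_L[symmetric] e_int[symmetric]
    by (intro antisym) auto
  have N'_fin: "(\<integral>\<^sup>+ s. h s \<partial>N') \<noteq> \<infinity>"
    using N'_E E_fin by (auto simp: ennreal_mult_top top_unique)
  have "(\<integral>\<^sup>+ s. h s \<partial>N') \<le> (\<integral>\<^sup>+ s. h s \<partial>L)"
    using N'_E unfolding E_L by (simp add: ennreal_mult_le_mult_iff)
  then have "(\<integral>\<^sup>+ s. h s \<partial>L) = (\<integral>\<^sup>+ s. h s \<partial>N')" using L_N' by simp
  \<comment> \<open>\<open>h\<close> is positive on \<open>I\<close> because \<open>g\<close> is,
    and it is finite there, so equal integrals force equal measures.\<close>
  then have "emeasure L I = emeasure N' I"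
    using L_sets N'_sets L_le N'_fin g_pos
    by (intro emeasure_eq_of_nn_integral_eq[where h = h])
      (auto simp: h_def I_def measurable_cong_sets[OF L_sets refl] h_meas[unfolded h_def I_def])
  then have N_I: "emeasure N I = 2 * emeasure lborel I" by (simp add: L_em N'_em)

  \<comment> \<open>Rigidity in the pointwise estimate and the length of the curve\<close>
  have "AE z in lebesgue. e z \<le> q z"
  proof (rule ccontr)
    assume "\<not> ?thesis"
    then have "(\<integral>\<^sup>+ z. q z \<partial>lebesgue) < (\<integral>\<^sup>+ z. e z \<partial>lebesgue)"
      using q_le q_E e_int E_fin by (intro nn_integral_less) auto
    with q_E show False by simp
  qed
  \<comment> \<open>Off \<open>m -\<close> followed by \<open>I\<close> in preimage,
    \<open>q\<close> vanishes, hence so does \<open>e\<close>, and with it the speed, as both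
    summands of \<open>e\<close> are nonnegative. All arc length therefore lies over
    \<open>I\<close>.\<close>
  then have "AE z in lebesgue. ennreal (norm (w z)) * indicator UNIV z = ennreal (norm (w z)) * indicator (m -` I) z"
  proof eventually_elim
    case (elim z)
    show ?case
    proof (cases "m z \<in> I")
      case False
      then have "e z = 0" using elim by (simp add: q_def h_def)
      then have "(norm (w z))\<^sup>2 + W (v z) \<le> 0" by (simp add: e_def ennreal_eq_0_iff)
      then have "(norm (w z))\<^sup>2 \<le> 0" using W_nonneg[of "v z"] by linarith
      then show ?thesis by simp
    qed simp
  qed
  then have "emeasure \<mu> UNIV = emeasure \<mu> (m -` I)"
    using measurable_sets[OF m_meas I]
    unfolding \<mu>_def by (subst (1 2) emeasure_density) (auto intro: nn_integral_cong_AE)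
  also have "\<dots> = emeasure N I" unfolding N_def by (subst emeasure_distr) (auto simp: \<mu>_space)
  also have "\<dots> = ennreal D"
  proof -
    have "D \<ge> 0" by (simp add: D setdist_pos_le)
    then have "emeasure lborel I = ennreal (D/2)" by (simp add: I_def)
    then show ?thesis unfolding N_I using \<open>D \<ge> 0\<close>
      by (simp add: ennreal_mult[symmetric] flip: ennreal_numeral)
  qed
  finally have total: "emeasure \<mu> UNIV = ennreal D" .
  \<comment> \<open>Any two points of the curve are at most its total length apart; letting
    \<open>n\<close> grow yields the end points.\<close>
  have bound: "norm (v (real n) - v (- real n)) \<le> D" for n
  proof -
    have "ennreal (norm (v (real n) - v (- real n))) \<le> emeasure \<mu> UNIV"
      by (rule order_trans[OF v_le]) (auto intro: emeasure_mono simp: \<mu>_sets)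
    then show ?thesis unfolding total by (simp add: D setdist_pos_le)
  qed
  have "(\<lambda>n. v (real n)) \<longlonglongrightarrow> Ap"
    by (rule filterlim_compose[OF v_top filterlim_real_sequentially])
  moreover have "(\<lambda>n. v (- real n)) \<longlonglongrightarrow> Am"
    by (intro filterlim_compose[OF v_bot] filterlim_compose[OF filterlim_uminus_at_bot_at_top filterlim_real_sequentially])
  ultimately have "(\<lambda>n. norm (v (real n) - v (- real n))) \<longlonglongrightarrow> norm (Ap - Am)"
    by (intro tendsto_intros)
  then show "norm (Ap - Am) \<le> D" by (rule LIMSEQ_le_const2) (use bound in auto)
qed

end
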